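(* Let $f,\psi:[0,\infty)\to\mathbb{R}$ be two functions such that $\psi$ is positive, increasing, and $\psi(t)\to\infty$ as $t\to\infty$. Let $\ell\in\mathbb{R}$ with $\ell\neq 0$. If $$\frac{f(t)}{\psi(t)}\longrightarrow \ell\quad\text{as } t\to\infty,$$ then $$\frac{R_t(f)}{\psi(t)}\longrightarrow |\ell|\quad\text{as } t\to\infty.$$
   Context: For a function $f:[0,\infty)\to\mathbb{R}$ and $t\ge 0$, the range of $f$ up to time $t$ is $R_t(f)=\sup_{0\le s\le t}f(s)-\inf_{0\le s\le t}f(s)$.
   Formalization: The function f is additionally assumed bounded on every interval [0,t], so that R_t(f) is finite; without this the claim fails, e.g. f(0)=0, f(s)=1/s on (0,1), f(s)=s for s≥1, ψ(t)=t+1. *)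

theory Defs
  imports "HOL-Analysis.Elementary_Metric_Spaces"
begin

text \<open>
  Functions on $[0,\infty)$ are represented by functions on all reals; values at negative
  arguments play no role. The supremum and infimum are those of the reals, so
  \<open>range_upto f t\<close> is meaningful only if \<open>f\<close> is bounded on \<open>{0..t}\<close>.
\<close>

definition range_upto :: "(real \<Rightarrow> real) \<Rightarrow> real \<Rightarrow> real" where
  "range_upto f t = (SUP s\<in>{0..t}. f s) - (INF s\<in>{0..t}. f s)"

end

theory Submission
  imports Defs
begin

text \<open>
  Neither the range nor \<open>\<bar>l\<bar>\<close> changes when \<open>f\<close> is replaced by \<open>-f\<close>, so let \<open>l \<ge> 0\<close>.
  Up to an error \<open>e * \<psi> t\<close> with \<open>e\<close> arbitrarily small, the supremum of \<open>f\<close> up to time \<open>t\<close>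
  is \<open>l * \<psi> t\<close> and the infimum is \<open>0\<close>. Indeed, \<open>f s\<close> lies within \<open>e * \<psi> s\<close> of \<open>l * \<psi> s\<close> as soon
  as \<open>s\<close> is at least some \<open>T\<close>, and \<open>0 < \<psi> s \<le> \<psi> t\<close> by monotonicity; on \<open>{0..T}\<close> the values of
  \<open>f\<close> are bounded by a constant, which is at most \<open>e * \<psi> t\<close> for large \<open>t\<close> because \<open>\<psi>\<close>
  diverges. Hence no increment of \<open>f\<close> on \<open>{0..t}\<close> exceeds \<open>(l + 2 * e) * \<psi> t\<close>, while
  \<open>f t - f 0\<close> is already at least \<open>(l - 2 * e) * \<psi> t\<close>.
\<close>

lemma range_upto_uminus: "range_upto (\<lambda>x. - f x) t = range_upto f t"
  by (simp add: range_upto_def Inf_real_def image_image)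

lemma increment_le_range_upto:
  assumes "bounded (f ` {0..t})" "s \<in> {0..t}" "u \<in> {0..t}"
  shows "f s - f u \<le> range_upto f t"
proof -
  have "f s \<le> (SUP s\<in>{0..t}. f s)"
    using assms by (intro cSUP_upper bounded_imp_bdd_above)
  moreover have "(INF s\<in>{0..t}. f s) \<le> f u"
    using assms by (intro cINF_lower bounded_imp_bdd_below)
  ultimately show ?thesis
    unfolding range_upto_def by linarith
qed

lemma range_upto_le:
  assumes "0 \<le> t" "\<And>s. s \<in> {0..t} \<Longrightarrow> a \<le> f s \<and> f s \<le> b"
  shows "range_upto f t \<le> b - a"
proof -
  have "(SUP s\<in>{0..t}. f s) \<le> b"
    using assms by (intro cSUP_least) auto
  moreover have "a \<le> (INF s\<in>{0..t}. f s)"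
    using assms by (intro cINF_greatest) auto
  ultimately show ?thesis
    unfolding range_upto_def by linarith
qed

text \<open>
  The sign of \<open>l\<close> decides which end of the range stays negligible: for \<open>l \<ge> 0\<close> the lower bound
  \<open>(l - e) * \<psi> s\<close> on \<open>f s\<close> may be weakened to \<open>- e * \<psi> t\<close>, uniformly in \<open>s \<le> t\<close>.
\<close>

lemma range_upto_tendsto_nonneg:
  fixes f \<psi> :: "real \<Rightarrow> real" and l :: real
  assumes bdd: "\<And>t. 0 \<le> t \<Longrightarrow> bounded (f ` {0..t})"
    and pos: "\<And>t. 0 \<le> t \<Longrightarrow> 0 < \<psi> t"
    and mono: "mono_on {0..} \<psi>"
    and div: "filterlim \<psi> at_top at_top"
    and "0 \<le> l"
    and lim: "((\<lambda>t. f t / \<psi> t) \<longlongrightarrow> l) at_top"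
  shows "((\<lambda>t. range_upto f t / \<psi> t) \<longlongrightarrow> l) at_top"
proof (rule tendstoI)
  fix \<epsilon> :: real
  assume "0 < \<epsilon>"
  \<comment> \<open>Each side of the estimate loses \<open>2 * e\<close>, and the final inequality has to be strict.\<close>
  define e where "e = \<epsilon> / 3"
  have "0 < e"
    using \<open>0 < \<epsilon>\<close> by (simp add: e_def)
  obtain T\<^sub>0 where T\<^sub>0: "\<And>t. T\<^sub>0 \<le> t \<Longrightarrow> \<bar>f t / \<psi> t - l\<bar> < e"
    using tendstoD[OF lim \<open>0 < e\<close>] by (auto simp: eventually_at_top_linorder dist_real_def)
  define T where "T = max 0 T\<^sub>0"
  have near: "(l - e) * \<psi> s \<le> f s \<and> f s \<le> (l + e) * \<psi> s" if "T \<le> s" for s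
  proof -
    have "0 < \<psi> s" "\<bar>f s / \<psi> s - l\<bar> < e"
      using that pos T\<^sub>0 by (auto simp: T_def)
    then have "l - e \<le> f s / \<psi> s" "f s / \<psi> s \<le> l + e"
      by linarith+
    with \<open>0 < \<psi> s\<close> show ?thesis
      by (simp add: pos_le_divide_eq pos_divide_le_eq)
  qed
  obtain C where C: "\<And>s. s \<in> {0..T} \<Longrightarrow> \<bar>f s\<bar> \<le> C"
    using bdd[of T] unfolding bounded_iff T_def by force
  have "\<forall>\<^sub>F t in at_top. C / e \<le> \<psi> t"
    using div by (simp add: filterlim_at_top)
  then show "\<forall>\<^sub>F t in at_top. dist (range_upto f t / \<psi> t) l < \<epsilon>"
    using eventually_ge_at_top[of T]
  proof eventually_elim
    case (elim t)
    have "0 \<le> t" "0 < \<psi> t"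
      using elim pos by (auto simp: T_def)
    have C_le: "C \<le> e * \<psi> t"
      using elim \<open>0 < e\<close> by (simp add: pos_divide_le_eq mult.commute)
    have bounds: "- e * \<psi> t \<le> f s \<and> f s \<le> (l + e) * \<psi> t" if "s \<in> {0..t}" for s
    proof (cases "s \<le> T")
      case True
      then have "\<bar>f s\<bar> \<le> e * \<psi> t"
        using C[of s] C_le that by simp
      moreover have "0 \<le> l * \<psi> t"
        using \<open>0 \<le> l\<close> \<open>0 < \<psi> t\<close> by simp
      ultimately show ?thesis
        by (auto simp: distrib_right)
    next
      case False
      have "0 < \<psi> s" "\<psi> s \<le> \<psi> t"
        using that pos mono by (auto intro: mono_onD)
      then have "e * \<psi> s \<le> e * \<psi> t" "(l + e) * \<psi> s \<le> (l + e) * \<psi> t" "0 \<le> l * \<psi> s"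
        using \<open>0 < e\<close> \<open>0 \<le> l\<close> by (auto intro: mult_left_mono)
      with near[of s] False show ?thesis
        by (auto simp: left_diff_distrib)
    qed
    have "range_upto f t \<le> (l + e) * \<psi> t - (- e * \<psi> t)"
      using \<open>0 \<le> t\<close> bounds by (rule range_upto_le)
    then have upper: "range_upto f t \<le> (l + 2 * e) * \<psi> t"
      by (simp add: algebra_simps)
    have "f t - f 0 \<le> range_upto f t"
      using \<open>0 \<le> t\<close> bdd by (intro increment_le_range_upto) auto
    moreover have "(l - e) * \<psi> t \<le> f t" "f 0 \<le> e * \<psi> t"
      using near[of t] elim C[of 0] C_le by (auto simp: T_def)
    ultimately have lower: "(l - 2 * e) * \<psi> t \<le> range_upto f t"
      by (simp add: algebra_simps)
    have "l - 2 * e \<le> range_upto f t / \<psi> t" "range_upto f t / \<psi> t \<le> l + 2 * e"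
      using upper lower \<open>0 < \<psi> t\<close> by (simp_all add: pos_le_divide_eq pos_divide_le_eq)
    then show ?case
      using \<open>0 < \<epsilon>\<close> by (simp add: dist_real_def e_def abs_less_iff)
  qed
qed

theorem theorem2:
  fixes f \<psi> :: "real \<Rightarrow> real" and l :: real
  assumes f_locally_bounded: "\<And>t. 0 \<le> t \<Longrightarrow> bounded (f ` {0..t})"
    and \<psi>_pos: "\<And>t. 0 \<le> t \<Longrightarrow> 0 < \<psi> t"
    and \<psi>_incr: "mono_on {0..} \<psi>"
    and \<psi>_lim: "filterlim \<psi> at_top at_top"
    and l_nonzero: "l \<noteq> 0"
    and f_lim: "((\<lambda>t. f t / \<psi> t) \<longlongrightarrow> l) at_top"
  shows "((\<lambda>t. range_upto f t / \<psi> t) \<longlongrightarrow> \<bar>l\<bar>) at_top"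
proof (cases "0 \<le> l")
  case True
  then show ?thesis
    using range_upto_tendsto_nonneg[OF f_locally_bounded \<psi>_pos \<psi>_incr \<psi>_lim _ f_lim] by simp
next
  case False
  have "bounded ((\<lambda>x. - f x) ` {0..t})" if "0 \<le> t" for t
    using f_locally_bounded[OF that] by (simp add: bounded_iff)
  moreover have "((\<lambda>t. - f t / \<psi> t) \<longlongrightarrow> - l) at_top"
    using tendsto_minus[OF f_lim] by simp
  ultimately have "((\<lambda>t. range_upto (\<lambda>x. - f x) t / \<psi> t) \<longlongrightarrow> - l) at_top"
    using False by (intro range_upto_tendsto_nonneg \<psi>_pos \<psi>_incr \<psi>_lim) auto
  with False show ?thesis
    by (simp add: range_upto_uminus)
qed

end
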